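(* Let $\varepsilon\in[0,\frac{616}{634})$ and let $S\in\mathbb{R}^{p\times n}$ be an $(\varepsilon,d,m)$ oblivious $\ell_2$-subspace embedding. Suppose $V\in\mathbb{R}^{n\times m}$ has full rank, $1<m\le p\le n$, $nm\mathbf{u}\le\frac1{12}$, $p^{3/2}\mathbf{u}\le\frac1{12}$, and $$\delta:=\frac{383\left(pm^{3/2}+\sqrt m\left(p^{3/2}\sqrt{1+\varepsilon}+n\|S\|_F\right)\right)}{\sqrt{1-\varepsilon}}\,\mathbf{u}\,\kappa(V)\le1 .$$ Let $\hat Q$ be the matrix computed in floating point arithmetic by $\texttt{randQR}$ applied to $V$ with the single sketch $S$. Then, with probability at least $1-d$, $\kappa(\hat Q)=O(1)$; in fact $$\kappa(\hat Q)\le\frac{33}{25\sqrt{\frac{1-\varepsilon}{1+\varepsilon}}-3}.$$ Therefore, if $\varepsilon\le0.9$, then (with the same probability) $\kappa(\hat Q)\le12.07$.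
   Context: Embeddings. For $\varepsilon\in[0,1)$, a matrix $S\in\mathbb{R}^{p\times n}$ is an $\varepsilon$-subspace embedding for a subspace $\mathcal V\subset\mathbb{R}^n$ if $|\langle x,y\rangle-\langle Sx,Sy\rangle|\le\varepsilon\|x\|_2\|y\|_2$ for all $x,y\in\mathcal V$. A random $S\in\mathbb{R}^{p\times n}$ is an $(\varepsilon,d,m)$ oblivious $\ell_2$-subspace embedding if, for any fixed $m$-dimensional subspace $\mathcal V\subset\mathbb{R}^n$, it is an $\varepsilon$-subspace embedding for $\mathcal V$ with probability at least $1-d$. Probabilities are over the draw of $S$; $V$ is fixed. The norm of $S$ appearing in $\delta$ is that of the drawn matrix, for which $\delta\le1$ is assumed. Notation. $\sigma_1\ge\dots\ge\sigma_m$ are singular values, $\kappa(X)=\sigma_1(X)/\sigma_m(X)$ for $X$ with $m$ columns, $\mathbf{u}$ is the unit roundoff, $\gamma_k=\frac{k\mathbf{u}}{1-k\mathbf{u}}$, $|A|$ is the entrywise absolute value (inequalities between such matrices are entrywise), hats denote computed quantities. Algorithm $\texttt{randQR}$ with a single sketch $S$ (the two-sketch algorithm with $S_1=S$, $S_2=I_p$): (1) compute $W=SV$; (2) compute a Householder QR factorization of $W$, keeping its $m\times m$ upper triangular factor $R$; (3) compute $Q=VR^{-1}$ by solving the triangular system $QR=V$ row by row. Output $Q,R$. Floating point. All steps are executed in the standard model of floating point arithmetic with unit roundoff $\mathbf{u}$ (each elementary operation has relative error at most $\mathbf{u}$, no overflow or underflow). The standard rounding error bounds for the subroutines are: a computed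 product of matrices $A,B$ with inner dimension $k$ is $AB+\Delta C$ with $|\Delta C|\le\gamma_k|A||B|$; Householder QR of $\hat W\in\mathbb{R}^{p\times m}$ returns upper triangular $\hat R$ for which there is a $Q_{tmp}\in\mathbb{R}^{p\times m}$ with exactly orthonormal columns and $\hat W+E_2=Q_{tmp}\hat R$, where $\|(E_2)_j\|_2\le\gamma_{29pm}\|\hat w_j\|_2$ for each column $j$; the row-wise solution of $Q\hat R=V$ returns $\hat Q$ with $\hat Q_{i,:}(\hat R+\Delta R_i)=V_{i,:}$, $|\Delta R_i|\le\gamma_m|\hat R|$, for each row $i$. *)

theory Defs
  imports "HOL-Probability.Probability"
begin

definition subspace_embedding :: "real \<Rightarrow> (real^'n) set \<Rightarrow> real^'n^'p \<Rightarrow> bool" where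
  "subspace_embedding \<epsilon> U S \<longleftrightarrow>
     (\<forall>x\<in>U. \<forall>y\<in>U. \<bar>x \<bullet> y - (S *v x) \<bullet> (S *v y)\<bar> \<le> \<epsilon> * norm x * norm y)"

definition oblivious_subspace_embedding ::
    "'a measure \<Rightarrow> ('a \<Rightarrow> real^'n^'p) \<Rightarrow> real \<Rightarrow> real \<Rightarrow> nat \<Rightarrow> bool" where
  "oblivious_subspace_embedding M S \<epsilon> d m \<longleftrightarrow>
     prob_space M \<and> S \<in> borel_measurable M \<and>
     (\<forall>U. subspace U \<and> dim U = m \<longrightarrow>
        measure M {\<omega> \<in> space M. subspace_embedding \<epsilon> U (S \<omega>)} \<ge> 1 - d)"

text \<open>
  The property \<open>P\<close> need not define a measurable set (it may quantify over all admissible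
  rounding errors), hence the formulation with a measurable event on which \<open>P\<close> holds.
\<close>
definition with_probability_at_least :: "'a measure \<Rightarrow> real \<Rightarrow> ('a \<Rightarrow> bool) \<Rightarrow> bool" where
  "with_probability_at_least M q P \<longleftrightarrow>
     (\<exists>A\<in>sets M. measure M A \<ge> q \<and> (\<forall>\<omega>\<in>A. P \<omega>))"

text \<open>
  The square roots of the eigenvalues of \<open>X\<^sup>T X\<close>. This is a finite nonempty set of reals; as \<open>X\<^sup>T X\<close>
  has as many eigenvalues (with multiplicity) as \<open>X\<close> has columns, \<open>\<sigma>\<^sub>1\<close> is its maximum and, for
  \<open>m\<close> columns, \<open>\<sigma>\<^sub>m\<close> is its minimum.
\<close>
definition singular_values :: "real^'m^'n \<Rightarrow> real set" where
  "singular_values X =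
     {\<sigma>. 0 \<le> \<sigma> \<and> (\<exists>v. v \<noteq> 0 \<and> (transpose X ** X) *v v = \<sigma>\<^sup>2 *\<^sub>R v)}"

definition sigma_max :: "real^'m^'n \<Rightarrow> real" where
  "sigma_max X = Max (singular_values X)"

definition sigma_min :: "real^'m^'n \<Rightarrow> real" where
  "sigma_min X = Min (singular_values X)"

text \<open>
  Meaningful only for \<open>X\<close> of full column rank: for rank-deficient \<open>X\<close>, where \<open>\<kappa>(X) = \<infinity>\<close>, division
  by zero makes this value \<open>0\<close>. Upper bounds on it have to be accompanied by full rank.
\<close>
definition cond_number :: "real^'m^'n \<Rightarrow> real" where
  "cond_number X = sigma_max X / sigma_min X"

definition gamma :: "nat \<Rightarrow> real \<Rightarrow> real" where
  "gamma k u = real k * u / (1 - real k * u)"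

definition upper_triangular :: "real^'m::{finite,wellorder}^'m::{finite,wellorder} \<Rightarrow> bool" where
  "upper_triangular R \<longleftrightarrow> (\<forall>i j. j < i \<longrightarrow> R $ i $ j = 0)"

text \<open>
  The following relations hold between the inputs and every possible computed output of a
  floating point subroutine with unit roundoff \<open>u\<close>, as specified by its standard rounding error
  bound. On matrices, \<open>\<bar>A\<bar>\<close> and \<open>\<le>\<close> are entrywise.
\<close>

definition fl_matrix_product ::
    "real \<Rightarrow> real^'k^'p \<Rightarrow> real^'m^'k \<Rightarrow> real^'m^'p \<Rightarrow> bool" where
  "fl_matrix_product u A B C \<longleftrightarrow>
     (\<exists>E. C = A ** B + E \<and> \<bar>E\<bar> \<le> gamma CARD('k) u *\<^sub>R (\<bar>A\<bar> ** \<bar>B\<bar>))"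

definition fl_householder_qr ::
    "real \<Rightarrow> real^'m::{finite,wellorder}^'p \<Rightarrow>
     real^'m::{finite,wellorder}^'m::{finite,wellorder} \<Rightarrow> bool" where
  "fl_householder_qr u W R \<longleftrightarrow>
     upper_triangular R \<and>
     (\<exists>(Q :: real^'m::{finite,wellorder}^'p) E. transpose Q ** Q = mat 1 \<and> W + E = Q ** R \<and>
        (\<forall>j. norm (column j E) \<le> gamma (29 * CARD('p) * CARD('m)) u * norm (column j W)))"

text \<open>The perturbation of \<open>R\<close> may be different for each row \<open>i\<close> of the solution \<open>Q\<close> of \<open>Q R = V\<close>.\<close>
definition fl_triangular_row_solve ::
    "real \<Rightarrow> real^'m^'m \<Rightarrow> real^'m^'n \<Rightarrow> real^'m^'n \<Rightarrow> bool" where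
  "fl_triangular_row_solve u R V Q \<longleftrightarrow>
     (\<forall>i. \<exists>D. row i Q v* (R + D) = row i V \<and> \<bar>D\<bar> \<le> gamma CARD('m) u *\<^sub>R \<bar>R\<bar>)"

definition fl_randQR ::
    "real \<Rightarrow> real^'n^'p \<Rightarrow> real^'m::{finite,wellorder}^'n \<Rightarrow>
     real^'m::{finite,wellorder}^'n \<Rightarrow> real^'m::{finite,wellorder}^'m::{finite,wellorder} \<Rightarrow> bool" where
  "fl_randQR u S V Q R \<longleftrightarrow>
     (\<exists>W. fl_matrix_product u S V W \<and> fl_householder_qr u W R \<and>
          fl_triangular_row_solve u R V Q)"

text \<open>The norm of the type \<^typ>\<open>real^'n^'p\<close> is the Frobenius norm, so \<open>norm S\<close> is \<open>\<parallel>S\<parallel>\<^sub>F\<close>.\<close>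
definition randQR_delta :: "real \<Rightarrow> real \<Rightarrow> real^'n^'p \<Rightarrow> real^'m^'n \<Rightarrow> real" where
  "randQR_delta u \<epsilon> S V =
     383 * (real CARD('p) * real CARD('m) powr (3/2) +
            sqrt (real CARD('m)) *
              (real CARD('p) powr (3/2) * sqrt (1 + \<epsilon>) + real CARD('n) * norm S))
         / sqrt (1 - \<epsilon>) * u * cond_number V"

end

theory Submission
  imports Defs
begin

text \<open>
  Condition on the event that \<open>S\<close> embeds the range of \<open>V\<close>. Then \<open>\<delta> \<le> 1\<close> makes the errors of the
  sketch and of the Householder factorization small relative to \<open>\<surd>(1 - \<epsilon>) \<sigma>\<^sub>m(V)\<close>, so that
  \<open>\<parallel>R y\<parallel>\<close> is comparable to \<open>\<parallel>V y\<parallel>\<close>, with constants close to \<open>\<surd>(1 - \<epsilon>)\<close> and \<open>\<surd>(1 + \<epsilon>)\<close>.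
  The row-wise solve leaves a residual \<open>Q R - V\<close> with
  \<open>\<parallel>(Q R - V) y\<parallel> \<le> \<phi> \<sigma>\<^sub>1(Q) \<parallel>R y\<parallel>\<close> for a small \<open>\<phi>\<close>. Substituting \<open>z = R y\<close> first bounds \<open>\<sigma>\<^sub>1(Q)\<close>,
  by absorbing the residual, and then bounds \<open>\<parallel>Q z\<parallel>\<close> from below.
\<close>

subsection \<open>Frobenius norm and singular values\<close>

text \<open>The two element types may differ, so entries of a vector can be compared with rows of a
  matrix, as in the bounds on \<open>A *v x\<close> and on the residual of the triangular
  solve.\<close>

lemma norm_vec_le_componentwise:
  fixes x :: "'a::real_normed_vector^'i" and y :: "'b::real_normed_vector^'i"
  assumes "0 \<le> c" and "\<And>i. norm (x $ i) \<le> c * norm (y $ i)"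
  shows "norm x \<le> c * norm y"
proof -
  have "norm x \<le> L2_set (\<lambda>i. c * norm (y $ i)) UNIV"
    unfolding norm_vec_def by (rule L2_set_mono) (auto simp: assms)
  also have "\<dots> = c * norm y"
    using assms(1) by (simp add: norm_vec_def L2_set_right_distrib)
  finally show ?thesis .
qed

lemma norm_matrix_vector_mult_le:
  fixes A :: "real^'n^'m"
  shows "norm (A *v x) \<le> norm A * norm x"
proof -
  have "norm (A *v x) \<le> norm x * norm A"
    by (rule norm_vec_le_componentwise)
      (simp_all add: matrix_vector_mul_component Cauchy_Schwarz_ineq2 mult.commute[of "norm x"])
  then show ?thesis by (simp add: mult.commute)
qed

lemma norm_transpose:
  fixes A :: "real^'n^'m"
  shows "norm (transpose A) = norm A"
proof -
  have "(\<Sum>i\<in>UNIV. (norm (transpose A $ i))\<^sup>2) = (\<Sum>i\<in>UNIV. (norm (A $ i))\<^sup>2)"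
    by (simp add: norm_vec_def L2_set_def real_sqrt_pow2 sum_nonneg transpose_def) (rule sum.swap)
  then show ?thesis by (simp add: norm_vec_def[of A] norm_vec_def[of "transpose A"] L2_set_def)
qed

lemma norm_matrix_le_columns:
  fixes A :: "real^'n^'m" and B :: "real^'n^'k"
  assumes "0 \<le> c" and "\<And>j. norm (column j A) \<le> c * norm (column j B)"
  shows "norm A \<le> c * norm B"
proof -
  have "norm (transpose A) \<le> c * norm (transpose B)"
    by (rule norm_vec_le_componentwise) (use assms in \<open>simp_all add: transpose_def column_def\<close>)
  then show ?thesis by (simp add: norm_transpose)
qed

lemma column_matrix_mult:
  fixes A :: "real^'n^'m"
  shows "column j (A ** B) = A *v column j B"
  by (simp add: column_def matrix_matrix_mult_def matrix_vector_mult_def)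

lemma norm_matrix_mult_le:
  fixes A :: "real^'n^'m"
  shows "norm (A ** B) \<le> norm A * norm B"
  by (rule norm_matrix_le_columns) (simp_all add: column_matrix_mult norm_matrix_vector_mult_le)

lemma norm_matrix_le_entries:
  fixes A B :: "real^'n^'m"
  assumes "0 \<le> c" and "\<bar>A\<bar> \<le> c *\<^sub>R B"
  shows "norm A \<le> c * norm B"
proof (intro norm_vec_le_componentwise \<open>0 \<le> c\<close>)
  fix i j
  have "\<bar>A $ i $ j\<bar> \<le> c * B $ i $ j"
    using assms(2) by (simp add: less_eq_vec_def abs_vec_def)
  also have "\<dots> \<le> c * \<bar>B $ i $ j\<bar>"
    using assms(1) by (simp add: mult_left_mono)
  finally show "norm (A $ i $ j) \<le> c * norm (B $ i $ j)" by simp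
qed

lemma norm_abs_matrix:
  fixes A :: "real^'n^'m"
  shows "norm \<bar>A\<bar> = norm A"
  by (simp add: norm_vec_def abs_vec_def)

text \<open>Every column is the image of a unit vector, so the columns compare with those of the
  identity, whose Frobenius norm is \<open>sqrt (real CARD('n))\<close>.\<close>

lemma norm_matrix_le_sqrt_columns:
  fixes A :: "real^'n^'m"
  assumes "0 \<le> c" and "\<And>x. norm (A *v x) \<le> c * norm x"
  shows "norm A \<le> sqrt (real CARD('n)) * c"
proof -
  have "norm A \<le> c * norm (mat 1 :: real^'n^'n)"
    using assms(1)
  proof (rule norm_matrix_le_columns)
    fix j
    have "column j A = A *v axis j 1" "column j (mat 1 :: real^'n^'n) = mat 1 *v axis j 1"
      by (simp_all only: matrix_vector_mult_basis)
    then show "norm (column j A) \<le> c * norm (column j (mat 1 :: real^'n^'n))"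
      using assms(2)[of "axis j 1"] by simp
  qed
  also have "norm (mat 1 :: real^'n^'n) = sqrt (real CARD('n))"
  proof -
    have "norm ((mat 1 :: real^'n^'n) $ i) = 1" for i
    proof -
      have "(mat 1 :: real^'n^'n) $ i = axis i 1"
        by (auto simp: mat_def axis_def vec_eq_iff)
      then show ?thesis by simp
    qed
    then show ?thesis by (simp add: norm_vec_def[of "mat 1"] L2_set_def)
  qed
  finally show ?thesis by (simp add: mult.commute)
qed

section \<open>Singular values as extreme values on the unit sphere\<close>

lemma gram_inner:
  fixes X :: "real^'m^'n"
  shows "((transpose X ** X) *v v) \<bullet> w = (X *v v) \<bullet> (X *v w)"
  by (simp add: dot_lmul_matrix flip: matrix_vector_mul_assoc)

lemma norm_mult_orthonormal_columns:
  fixes Q :: "real^'n^'m"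
  assumes "transpose Q ** Q = mat 1"
  shows "norm (Q *v x) = norm x"
  using gram_inner[of Q x x] assms by (simp add: norm_eq_sqrt_inner)

text \<open>Moving from \<open>v\<close> in the direction \<open>f v\<close> changes the form to
  first order by \<open>2 * t * (f v \<bullet> f v)\<close>. If \<open>f v\<close> were nonzero, a
  small negative \<open>t\<close> would make the form negative.\<close>

lemma psd_form_zero:
  fixes f :: "'a::real_inner \<Rightarrow> 'a"
  assumes "linear f" and sym: "\<And>x y. f x \<bullet> y = x \<bullet> f y" and psd: "\<And>x. 0 \<le> f x \<bullet> x"
    and "f v \<bullet> v = 0"
  shows "f v = 0"
proof -
  interpret linear f by fact
  define a where "a = f v \<bullet> f v"
  define b where "b = f (f v) \<bullet> f v"
  have expand: "0 \<le> t * (2 * a + t * b)" for t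
  proof -
    have "f (f v) \<bullet> v = a" using sym[of "f v" v] by (simp add: a_def)
    then have "f (v + t *\<^sub>R f v) \<bullet> (v + t *\<^sub>R f v) = t * (2 * a + t * b)"
      using assms(4) by (simp add: add scale inner_add_left inner_add_right a_def b_def algebra_simps)
    with psd[of "v + t *\<^sub>R f v"] show ?thesis by simp
  qed
  have "0 \<le> b" unfolding b_def by (rule psd)
  have "a \<le> 0"
  proof (rule ccontr)
    assume "\<not> a \<le> 0"
    \<comment> \<open>With this choice \<open>2 * a + t * b = a * (b + 2) / (b + 1)\<close>; the
      \<open>1\<close> in the denominator also covers \<open>b = 0\<close>.\<close>
    define t where "t = - a / (b + 1)"
    have "t < 0" using \<open>\<not> a \<le> 0\<close> \<open>0 \<le> b\<close> by (simp add: t_def divide_neg_pos)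
    have "2 * a + t * b > 0"
      using \<open>\<not> a \<le> 0\<close> \<open>0 \<le> b\<close> by (simp add: t_def field_simps) (intro add_nonneg_pos mult_nonneg_nonneg; simp)
    with \<open>t < 0\<close> have "t * (2 * a + t * b) < 0" by (rule mult_neg_pos)
    with expand[of t] show False by simp
  qed
  then show ?thesis unfolding a_def by (metis inner_gt_zero_iff not_le)
qed

text \<open>One eigenvector is chosen for each singular value. Distinct nonnegative values have
  distinct squares, so these vectors are orthogonal and nonzero, hence independent, hence finitely
  many.\<close>

lemma singular_values_finite:
  fixes X :: "real^'m^'n"
  shows "finite (singular_values X)"
proof -
  define ev where "ev \<sigma> = (SOME v. v \<noteq> 0 \<and> (transpose X ** X) *v v = \<sigma>\<^sup>2 *\<^sub>R v)" for \<sigma>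
  have ev: "ev \<sigma> \<noteq> 0" "(transpose X ** X) *v ev \<sigma> = \<sigma>\<^sup>2 *\<^sub>R ev \<sigma>" "0 \<le> \<sigma>"
    if "\<sigma> \<in> singular_values X" for \<sigma>
    using that someI_ex[of "\<lambda>v. v \<noteq> 0 \<and> (transpose X ** X) *v v = \<sigma>\<^sup>2 *\<^sub>R v"]
    unfolding singular_values_def ev_def by auto
  have orth: "ev \<sigma> \<bullet> ev \<tau> = 0"
    if "\<sigma> \<in> singular_values X" "\<tau> \<in> singular_values X" "\<sigma> \<noteq> \<tau>" for \<sigma> \<tau>
  proof -
    have "\<sigma>\<^sup>2 * (ev \<sigma> \<bullet> ev \<tau>) = \<tau>\<^sup>2 * (ev \<sigma> \<bullet> ev \<tau>)"
      using gram_inner[of X "ev \<sigma>" "ev \<tau>"] gram_inner[of X "ev \<tau>" "ev \<sigma>"] ev that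
      by (simp add: inner_commute)
    moreover have "\<sigma>\<^sup>2 \<noteq> \<tau>\<^sup>2" using ev that by simp
    ultimately show ?thesis by simp
  qed
  have inj: "inj_on ev (singular_values X)"
    using ev(1) orth by (auto intro!: inj_onI) (metis inner_eq_zero_iff)
  have "pairwise orthogonal (ev ` singular_values X)"
    unfolding pairwise_def orthogonal_def using orth by auto
  moreover have "0 \<notin> ev ` singular_values X" using ev(1) by auto
  ultimately have "finite (ev ` singular_values X)"
    by (intro independent_imp_finite pairwise_orthogonal_independent)
  then show ?thesis using inj by (rule finite_imageD)
qed

lemma singular_value_norm:
  fixes X :: "real^'m^'n"
  assumes "\<sigma> \<in> singular_values X"
  obtains v where "norm v = 1" and "norm (X *v v) = \<sigma>"
proof -
  from assms obtain v where v: "v \<noteq> 0" "(transpose X ** X) *v v = \<sigma>\<^sup>2 *\<^sub>R v" "0 \<le> \<sigma>"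
    by (auto simp: singular_values_def)
  have "(norm (X *v v))\<^sup>2 = (\<sigma> * norm v)\<^sup>2"
    using gram_inner[of X v v] v(2) by (simp add: power2_norm_eq_inner power_mult_distrib)
  then have "norm (X *v v) = \<sigma> * norm v" using v(3) by simp
  with v(1) have "norm (X *v (v /\<^sub>R norm v)) = \<sigma>"
    by (simp add: matrix_vector_mult_scaleR)
  with v(1) that[of "v /\<^sub>R norm v"] show ?thesis by simp
qed

text \<open>
  For \<open>s = 1\<close> (a maximizer) and \<open>s = -1\<close> (a minimizer) the quadratic form of
  \<open>s (\<sigma>\<^sup>2 - X\<^sup>T X)\<close> is nonnegative and vanishes at \<open>v\<close>, so that \<open>v\<close> is in its kernel.
\<close>
lemma singular_value_extremal:
  fixes X :: "real^'m^'n"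
  assumes "norm v = 1" and "s = 1 \<or> s = -1"
    and extr: "\<And>w. norm w = 1 \<Longrightarrow> s * norm (X *v w) \<le> s * norm (X *v v)"
  shows "norm (X *v v) \<in> singular_values X"
proof -
  let ?\<sigma> = "norm (X *v v)"
  let ?A = "transpose X ** X"
  define f where "f w = s *\<^sub>R (?\<sigma>\<^sup>2 *\<^sub>R w - ?A *v w)" for w
  have form: "f x \<bullet> y = s * (?\<sigma>\<^sup>2 * (x \<bullet> y) - (X *v x) \<bullet> (X *v y))" for x y
    by (simp add: f_def inner_diff_left gram_inner)
  have "linear f"
    by (rule linearI) (simp_all add: f_def matrix_vector_right_distrib matrix_vector_mult_scaleR algebra_simps)
  moreover have "f x \<bullet> y = x \<bullet> f y" for x y
    using form[of x y] form[of y x] by (simp add: inner_commute)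
  moreover have "0 \<le> f x \<bullet> x" for x
  proof (cases "x = 0")
    case False
    have "s * norm (X *v (x /\<^sub>R norm x)) \<le> s * ?\<sigma>"
      using False by (intro extr) simp
    then have "s * norm (X *v x) \<le> s * (?\<sigma> * norm x)"
      using False by (simp add: matrix_vector_mult_scaleR field_simps)
    with assms(2) have "s * (norm (X *v x))\<^sup>2 \<le> s * (?\<sigma> * norm x)\<^sup>2"
      by (auto intro: power_mono)
    then show ?thesis
      unfolding form by (simp add: power2_norm_eq_inner power_mult_distrib right_diff_distrib)
  qed (simp add: form)
  moreover have "f v \<bullet> v = 0"
    using assms(1) by (simp add: form flip: power2_norm_eq_inner)
  ultimately have "f v = 0" by (rule psd_form_zero)
  then have "?A *v v = ?\<sigma>\<^sup>2 *\<^sub>R v" using assms(2) by (auto simp: f_def)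
  moreover have "v \<noteq> 0" using assms(1) by auto
  ultimately show ?thesis by (auto simp: singular_values_def)
qed

text \<open>Compactness of the sphere; the sign of \<open>s\<close> selects a maximizer or a
  minimizer, in the form that \<open>singular_value_extremal\<close> expects.\<close>

lemma extremal_unit_vector:
  fixes X :: "real^'m^'n" and s :: real
  obtains v where "norm v = 1" and "\<And>w. norm w = 1 \<Longrightarrow> s * norm (X *v w) \<le> s * norm (X *v v)"
proof -
  have "continuous_on (sphere 0 1) (\<lambda>v. s * norm (X *v v))"
    by (intro continuous_intros linear_continuous_on) (simp add: linear_linear)
  moreover have "sphere (0 :: real^'m) 1 \<noteq> {}" by simp
  ultimately obtain v where "v \<in> sphere 0 1"
      and "\<forall>w\<in>sphere 0 1. s * norm (X *v w) \<le> s * norm (X *v v)"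
    using continuous_attains_sup[OF compact_sphere] by blast
  with that show ?thesis by simp
qed

lemma norm_mult_eq_unit:
  fixes X :: "real^'m^'n"
  assumes "norm w \<noteq> 0"
  shows "norm (X *v w) = norm (X *v (w /\<^sub>R norm w)) * norm w"
  using assms by (simp add: matrix_vector_mult_scaleR)

text \<open>The maximum of \<open>norm (X *v v)\<close> over the unit sphere is itself a singular
  value; homogeneity extends the bound to all vectors. The bound by \<open>sigma_min\<close> is
  dual.\<close>

lemma norm_mult_le_sigma_max:
  fixes X :: "real^'m^'n"
  shows "norm (X *v w) \<le> sigma_max X * norm w"
proof (cases "w = 0")
  case False
  obtain v where v: "norm v = 1" "\<And>w. norm w = 1 \<Longrightarrow> 1 * norm (X *v w) \<le> 1 * norm (X *v v)"
    using extremal_unit_vector[where s = 1] by blast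
  have "norm (X *v (w /\<^sub>R norm w)) \<le> norm (X *v v)" using v(2)[of "w /\<^sub>R norm w"] False by simp
  also have "\<dots> \<le> sigma_max X"
    unfolding sigma_max_def using singular_value_extremal[OF v(1) _ v(2)]
    by (intro Max_ge singular_values_finite) simp
  finally show ?thesis
    using False by (simp add: norm_mult_eq_unit[of w X] mult_right_mono)
qed simp

lemma sigma_min_le_norm_mult:
  fixes X :: "real^'m^'n"
  shows "sigma_min X * norm w \<le> norm (X *v w)"
proof (cases "w = 0")
  case False
  obtain v where v: "norm v = 1"
      "\<And>w. norm w = 1 \<Longrightarrow> -1 * norm (X *v w) \<le> -1 * norm (X *v v)"
    using extremal_unit_vector[where s = "-1"] by blast
  have "sigma_min X \<le> norm (X *v v)"
    unfolding sigma_min_def using singular_value_extremal[OF v(1) _ v(2)]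
    by (intro Min_le singular_values_finite) simp
  also have "\<dots> \<le> norm (X *v (w /\<^sub>R norm w))" using v(2)[of "w /\<^sub>R norm w"] False by simp
  finally show ?thesis
    using False by (simp add: norm_mult_eq_unit[of w X] mult_right_mono)
qed simp

lemma singular_values_nonempty:
  fixes X :: "real^'m^'n"
  shows "singular_values X \<noteq> {}"
proof -
  obtain v where v: "norm v = 1" "\<And>w. norm w = 1 \<Longrightarrow> 1 * norm (X *v w) \<le> 1 * norm (X *v v)"
    using extremal_unit_vector[where s = 1] by blast
  then show ?thesis using singular_value_extremal[OF v(1) _ v(2)] by auto
qed

lemma sigma_max_attained:
  fixes X :: "real^'m^'n"
  obtains v where "norm v = 1" and "norm (X *v v) = sigma_max X"
  using Max_in[OF singular_values_finite singular_values_nonempty] singular_value_norm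
  unfolding sigma_max_def by metis

lemma sigma_min_attained:
  fixes X :: "real^'m^'n"
  obtains v where "norm v = 1" and "norm (X *v v) = sigma_min X"
  using Min_in[OF singular_values_finite singular_values_nonempty] singular_value_norm
  unfolding sigma_min_def by metis

lemma sigma_min_pos:
  fixes X :: "real^'m^'n"
  assumes "rank X = CARD('m)"
  shows "0 < sigma_min X"
proof -
  obtain v where v: "norm v = 1" "norm (X *v v) = sigma_min X" by (rule sigma_min_attained)
  have "inj ((*v) X)" using assms by (simp add: full_rank_injective)
  then have "X *v v \<noteq> 0" using v(1) by (metis injD matrix_vector_mult_0_right norm_zero zero_neq_one)
  with v(2) show ?thesis by (metis zero_less_norm_iff)
qed

lemma sigma_min_le_sigma_max:
  fixes X :: "real^'m^'n"
  shows "sigma_min X \<le> sigma_max X"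
proof -
  obtain v where "norm v = 1" "norm (X *v v) = sigma_min X" by (rule sigma_min_attained)
  with norm_mult_le_sigma_max[of X v] show ?thesis by simp
qed

text \<open>A positive lower bound forces injectivity, hence full rank, so the quotient defining
  \<open>cond_number\<close> is not a division by zero. Since \<open>sigma_min\<close> is attained,
  \<open>l\<close> also bounds it from below.\<close>

lemma cond_number_le:
  fixes X :: "real^'m^'n"
  assumes "0 < l" and lower: "\<And>x. l * norm x \<le> norm (X *v x)" and "sigma_max X \<le> K * l" and "0 \<le> K"
  shows "rank X = CARD('m) \<and> cond_number X \<le> K"
proof
  have "inj ((*v) X)"
  proof (rule injI)
    fix x y assume "X *v x = X *v y"
    then have "X *v (x - y) = 0" by (simp add: matrix_vector_mult_diff_distrib)
    with lower[of "x - y"] \<open>0 < l\<close> show "x = y" by (simp add: mult_le_0_iff)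
  qed
  then show "rank X = CARD('m)" by (simp add: full_rank_injective)
  obtain v where "norm v = 1" "norm (X *v v) = sigma_min X" by (rule sigma_min_attained)
  with lower[of v] have "l \<le> sigma_min X" by simp
  then have "K * l \<le> K * sigma_min X" using \<open>0 \<le> K\<close> by (rule mult_left_mono)
  with assms(3) have "sigma_max X \<le> K * sigma_min X" by simp
  with \<open>l \<le> sigma_min X\<close> \<open>0 < l\<close> show "cond_number X \<le> K"
    by (simp add: cond_number_def divide_le_eq)
qed

subsection \<open>Rounding errors\<close>

lemma gamma_bounds:
  assumes "0 \<le> u" and "real k * u \<le> b" and "b < 1"
  shows "0 \<le> gamma k u" and "gamma k u \<le> real k * u / (1 - b)"
  using assms by (auto simp: gamma_def intro!: frac_le)

lemma fl_matrix_product_error: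
  fixes A :: "real^'k^'p" and B :: "real^'m^'k"
  assumes "fl_matrix_product u A B C" and "0 \<le> gamma CARD('k) u"
  shows "norm (C - A ** B) \<le> gamma CARD('k) u * (norm A * norm B)"
proof -
  from assms(1) obtain E where C: "C = A ** B + E" and E: "\<bar>E\<bar> \<le> gamma CARD('k) u *\<^sub>R (\<bar>A\<bar> ** \<bar>B\<bar>)"
    by (auto simp: fl_matrix_product_def)
  have "norm E \<le> gamma CARD('k) u * norm (\<bar>A\<bar> ** \<bar>B\<bar>)"
    using assms(2) E by (rule norm_matrix_le_entries)
  also have "\<dots> \<le> gamma CARD('k) u * (norm A * norm B)"
    using assms(2) norm_matrix_mult_le[of "\<bar>A\<bar>" "\<bar>B\<bar>"]
    by (intro mult_left_mono) (simp_all add: norm_abs_matrix)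
  finally show ?thesis by (simp add: C)
qed

text \<open>The orthonormal factor preserves norms and can be eliminated: the later estimates see
  \<open>R\<close> only through the norms of \<open>R *v y\<close>.\<close>

lemma fl_householder_qr_error:
  fixes W :: "real^'m::{finite,wellorder}^'p"
  assumes "fl_householder_qr u W R" and "0 \<le> gamma (29 * CARD('p) * CARD('m)) u"
  obtains E where "norm E \<le> gamma (29 * CARD('p) * CARD('m)) u * norm W"
    and "\<And>y. norm (R *v y) = norm ((W + E) *v y)"
proof -
  from assms(1) obtain Q :: "real^'m::{finite,wellorder}^'p" and E where Q: "transpose Q ** Q = mat 1" "W + E = Q ** R"
    and E: "\<And>j. norm (column j E) \<le> gamma (29 * CARD('p) * CARD('m)) u * norm (column j W)"
    unfolding fl_householder_qr_def by blast
  show ?thesis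
  proof
    show "norm E \<le> gamma (29 * CARD('p) * CARD('m)) u * norm W"
      using assms(2) E by (rule norm_matrix_le_columns)
    show "norm (R *v y) = norm ((W + E) *v y)" for y
      using norm_mult_orthonormal_columns[OF Q(1), of "R *v y"]
      by (simp add: Q(2) matrix_vector_mul_assoc)
  qed
qed

text \<open>Entry \<open>i\<close> of the residual is \<open>- (row i Q \<bullet> (D *v y))\<close>,
  where \<open>D\<close> depends on \<open>i\<close>. Its bound is proportional to the norm of row
  \<open>i\<close> of \<open>Q\<close>, so the entries combine to the Frobenius norm of
  \<open>Q\<close>.\<close>

lemma fl_triangular_row_solve_error:
  fixes Q :: "real^'m^'n"
  assumes "fl_triangular_row_solve u R V Q" and "0 \<le> gamma CARD('m) u"
  shows "norm (Q *v (R *v y) - V *v y) \<le> gamma CARD('m) u * norm R * norm y * norm Q"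
proof (rule norm_vec_le_componentwise)
  fix i
  from assms(1) obtain D where D: "row i Q v* (R + D) = row i V" "\<bar>D\<bar> \<le> gamma CARD('m) u *\<^sub>R \<bar>R\<bar>"
    unfolding fl_triangular_row_solve_def by blast
  have "norm D \<le> gamma CARD('m) u * norm R"
    using norm_matrix_le_entries[OF assms(2) D(2)] by (simp add: norm_abs_matrix)
  have "(V *v y) $ i = row i V \<bullet> y" by (simp add: matrix_vector_mul_component row_def)
  also have "\<dots> = row i Q \<bullet> (R *v y) + row i Q \<bullet> (D *v y)"
    by (simp add: D(1)[symmetric] dot_lmul_matrix matrix_vector_mult_add_rdistrib inner_add_right)
  finally have "(Q *v (R *v y) - V *v y) $ i = - (row i Q \<bullet> (D *v y))"
    by (simp add: matrix_vector_mul_component row_def)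
  then have "norm ((Q *v (R *v y) - V *v y) $ i) \<le> norm (row i Q) * norm (D *v y)"
    by (simp add: Cauchy_Schwarz_ineq2)
  also have "\<dots> \<le> norm (row i Q) * (norm D * norm y)"
    by (intro mult_left_mono norm_matrix_vector_mult_le) simp
  also have "\<dots> \<le> norm (row i Q) * (gamma CARD('m) u * norm R * norm y)"
    by (intro mult_left_mono mult_right_mono) (simp_all add: \<open>norm D \<le> _\<close>)
  finally show "norm ((Q *v (R *v y) - V *v y) $ i) \<le> gamma CARD('m) u * norm R * norm y * norm (Q $ i)"
    by (simp add: row_def mult_ac)
qed (simp add: assms(2))

text \<open>With \<open>c = a * (1 - \<phi>)\<close> the extreme stretchings of \<open>Q\<close> are
  at most \<open>1 / c\<close> and at least \<open>1 / b - \<phi> / c\<close>. Their quotient is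
  \<open>1 / (c / b - \<phi>)\<close>, and the hypothesis on \<open>K\<close> says, cleared of
  denominators, that \<open>K\<close> is at least this.\<close>

lemma cond_number_perturbed_quotient:
  fixes V Q :: "real^'m^'n" and R :: "real^'m^'m"
  assumes "rank V = CARD('m)" and "0 < a" and "0 < b" and "0 \<le> \<phi>" and "\<phi> < 1" and "0 < K"
    and R_lower: "\<And>y. a * norm (V *v y) \<le> norm (R *v y)"
    and R_upper: "\<And>y. norm (R *v y) \<le> b * norm (V *v y)"
    and residual: "\<And>y. norm (Q *v (R *v y) - V *v y) \<le> \<phi> * sigma_max Q * norm (R *v y)"
    and K: "1 + K * \<phi> \<le> K * (a * (1 - \<phi>) / b)"
  shows "rank Q = CARD('m) \<and> cond_number Q \<le> K"
proof -
  let ?N = "sigma_max Q"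
  \<comment> \<open>The lower bound transfers injectivity from \<open>V\<close> to the square matrix
    \<open>R\<close>, so every \<open>z\<close> can be written as \<open>R *v y\<close>.\<close>
  have "inj ((*v) R)"
  proof (rule injI)
    fix x y assume "R *v x = R *v y"
    then have "R *v (x - y) = 0" by (simp add: matrix_vector_mult_diff_distrib)
    with R_lower[of "x - y"] \<open>0 < a\<close> have "V *v x = V *v y"
      by (simp add: matrix_vector_mult_diff_distrib mult_le_0_iff)
    then show "x = y" using assms(1) by (metis full_rank_injective injD)
  qed
  then have surj: "\<exists>y. z = R *v y" for z
    using linear_injective_imp_surjective[of "(*v) R"] by (metis surjD matrix_vector_mul_linear)
  have upper: "norm (Q *v z) \<le> (1 / a + \<phi> * ?N) * norm z" for z
  proof -
    obtain y where z: "z = R *v y" using surj by blast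
    have "norm (Q *v z) \<le> norm (V *v y) + norm (Q *v z - V *v y)" by (simp add: norm_triangle_sub)
    also have "\<dots> \<le> norm z / a + \<phi> * ?N * norm z"
    proof (rule add_mono)
      show "norm (V *v y) \<le> norm z / a"
        using R_lower[of y] \<open>0 < a\<close> by (simp add: z pos_le_divide_eq mult.commute)
      show "norm (Q *v z - V *v y) \<le> \<phi> * ?N * norm z" unfolding z by (rule residual)
    qed
    finally show ?thesis by (simp add: algebra_simps)
  qed
  obtain v where "norm v = 1" "norm (Q *v v) = ?N" by (rule sigma_max_attained)
  \<comment> \<open>At a vector attaining \<open>sigma_max Q\<close> this quantity stands on both
    sides; \<open>\<phi> < 1\<close> allows absorbing it.\<close>
  with upper[of v] have N: "?N * (1 - \<phi>) \<le> 1 / a" by (simp add: algebra_simps)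
  define c where "c = a * (1 - \<phi>)"
  have "0 < c" using assms by (simp add: c_def)
  have N: "?N \<le> 1 / c" using N assms by (simp add: c_def field_simps)
  have K': "1 / c + K * (\<phi> / c) \<le> K / b"
    using K \<open>0 < c\<close> \<open>0 < b\<close> by (simp add: c_def[symmetric] field_simps)
  have \<phi>N: "\<phi> * ?N \<le> \<phi> / c" using mult_left_mono[OF N \<open>0 \<le> \<phi>\<close>] by simp
  then have K\<phi>N: "K * (\<phi> * ?N) \<le> K * (\<phi> / c)" using \<open>0 < K\<close> by (simp only: mult_le_cancel_left_pos)
  \<comment> \<open>The summand \<open>1 / c\<close> provides the strict inequality that makes the
    lower bound \<open>1 / b - \<phi> * ?N\<close> positive.\<close>
  have "0 < 1 / c" using \<open>0 < c\<close> by simp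
  then have "K * (\<phi> / c) < 1 / c + K * (\<phi> / c)" by (simp only: less_add_same_cancel2)
  with K\<phi>N have "K * (\<phi> * ?N) < 1 / c + K * (\<phi> / c)" by (rule order_le_less_trans)
  also note K'
  also have "K / b = K * (1 / b)" by simp
  finally have "K * (\<phi> * ?N) < K * (1 / b)" .
  then have "0 < 1 / b - \<phi> * ?N" using \<open>0 < K\<close> by (simp only: mult_less_cancel_left_pos diff_gt_0_iff_gt)
  moreover have "(1 / b - \<phi> * ?N) * norm z \<le> norm (Q *v z)" for z
  proof -
    obtain y where z: "z = R *v y" using surj by blast
    have "norm z / b - \<phi> * ?N * norm z \<le> norm (V *v y) - norm (Q *v z - V *v y)"
    proof (rule diff_mono)
      show "norm z / b \<le> norm (V *v y)"
        using R_upper[of y] \<open>0 < b\<close> by (simp add: z pos_divide_le_eq mult.commute)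
      show "norm (Q *v z - V *v y) \<le> \<phi> * ?N * norm z" unfolding z by (rule residual)
    qed
    also have "\<dots> \<le> norm (Q *v z)"
      using norm_triangle_sub[of "V *v y" "Q *v z"] by (simp add: norm_minus_commute)
    finally show ?thesis by (simp add: algebra_simps)
  qed
  moreover have "?N \<le> K * (1 / b - \<phi> * ?N)" using N K' K\<phi>N by (simp add: algebra_simps)
  ultimately show ?thesis using \<open>0 < K\<close> by (intro cond_number_le) auto
qed

section \<open>Explicit constants for the embedding and the roundoff\<close>

lemma embedding_norm_bounds:
  assumes "subspace_embedding \<epsilon> U S" and "x \<in> U" and "0 \<le> \<epsilon>" and "\<epsilon> \<le> 1"
  shows "sqrt (1 - \<epsilon>) * norm x \<le> norm (S *v x)" and "norm (S *v x) \<le> sqrt (1 + \<epsilon>) * norm x"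
proof -
  have "\<bar>(norm x)\<^sup>2 - (norm (S *v x))\<^sup>2\<bar> \<le> \<epsilon> * (norm x)\<^sup>2"
  proof -
    have "\<bar>x \<bullet> x - (S *v x) \<bullet> (S *v x)\<bar> \<le> \<epsilon> * norm x * norm x"
      using assms(1,2) unfolding subspace_embedding_def by blast
    then show ?thesis by (simp only: power2_norm_eq_inner[symmetric] power2_eq_square mult.assoc)
  qed
  then have *: "(1 - \<epsilon>) * (norm x)\<^sup>2 \<le> (norm (S *v x))\<^sup>2" "(norm (S *v x))\<^sup>2 \<le> (1 + \<epsilon>) * (norm x)\<^sup>2"
    by (simp_all add: left_diff_distrib distrib_right abs_le_iff)
  show "sqrt (1 - \<epsilon>) * norm x \<le> norm (S *v x)"
    using real_sqrt_le_mono[OF *(1)] by (simp add: real_sqrt_mult)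
  show "norm (S *v x) \<le> sqrt (1 + \<epsilon>) * norm x"
    using real_sqrt_le_mono[OF *(2)] by (simp add: real_sqrt_mult)
qed

text \<open>
  The bound is \<open>1 / (a (1 - \<phi>) / b - \<phi>)\<close> for \<open>a = 0.88 \<surd>(1 - \<epsilon>)\<close>, \<open>b = \<surd>(1 + \<epsilon>) + 0.12 \<surd>(1 - \<epsilon>)\<close>
  and \<open>\<phi> = 1/200\<close>.
\<close>
lemma cond_bound_constants:
  fixes \<epsilon> :: real
  assumes "0 \<le> \<epsilon>" and "\<epsilon> < 616 / 634"
  defines "s1 \<equiv> sqrt (1 - \<epsilon>)" and "s2 \<equiv> sqrt (1 + \<epsilon>)"
  defines "K \<equiv> 33 / (25 * sqrt ((1 - \<epsilon>) / (1 + \<epsilon>)) - 3)"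
  shows "0 < K"
    and "1 + K * (1 / 200) \<le> K * (22 / 25 * s1 * (1 - 1 / 200) / (s2 + 3 / 25 * s1))"
proof -
  define s where "s = s1 / s2"
  have s_eq: "sqrt ((1 - \<epsilon>) / (1 + \<epsilon>)) = s" by (simp add: s_def s1_def s2_def real_sqrt_divide)
  have "0 < s2" "0 < s1" using assms by (simp_all add: s1_def s2_def)
  \<comment> \<open>This is where the limit on \<open>\<epsilon>\<close> comes from:
    \<open>(1 - \<epsilon>) / (1 + \<epsilon>) > 9 / 625\<close> is equivalent to
    \<open>\<epsilon> < 616 / 634\<close>. It makes the denominator of \<open>K\<close>
    positive.\<close>
  have "3 / 25 < s"
    unfolding s_eq[symmetric] by (rule real_less_rsqrt) (use assms in \<open>simp add: power2_eq_square field_simps\<close>)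
  have "s \<le> 1" unfolding s_eq[symmetric] using assms by simp
  show "0 < K" using \<open>3 / 25 < s\<close> by (simp add: K_def s_eq)
  have "s1 = s * s2" using \<open>0 < s2\<close> by (simp add: s_def)
  have "22 / 25 * s1 * (1 - 1 / 200) / (s2 + 3 / 25 * s1)
      = 22 / 25 * s * (199 / 200) / (1 + 3 / 25 * s)"
  proof -
    have "s2 + 3 / 25 * s1 = s2 * (1 + 3 / 25 * s)"
      by (simp add: \<open>s1 = s * s2\<close> algebra_simps)
    moreover have "22 / 25 * s1 * (1 - 1 / 200) = s2 * (22 / 25 * s * (199 / 200))"
      by (simp add: \<open>s1 = s * s2\<close>)
    ultimately show ?thesis
      using \<open>0 < s2\<close> by (simp only: mult_divide_mult_cancel_left[OF less_imp_neq[THEN not_sym]])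
  qed
  also have "\<dots> \<ge> 22 / 25 * s * (199 / 200) / (28 / 25)"
    using \<open>3 / 25 < s\<close> \<open>s \<le> 1\<close> by (intro divide_left_mono mult_pos_pos) auto
  \<comment> \<open>The term \<open>(25 * s - 3) / 33\<close> is the reciprocal of
    \<open>K\<close>.\<close>
  also have "22 / 25 * s * (199 / 200) / (28 / 25) \<ge> (25 * s - 3) / 33 + 1 / 200"
    using \<open>3 / 25 < s\<close> \<open>s \<le> 1\<close> by (simp add: field_simps)
  finally have "(25 * s - 3) / 33 + 1 / 200 \<le> 22 / 25 * s1 * (1 - 1 / 200) / (s2 + 3 / 25 * s1)" .
  then have "K * ((25 * s - 3) / 33 + 1 / 200) \<le> K * (22 / 25 * s1 * (1 - 1 / 200) / (s2 + 3 / 25 * s1))"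
    using \<open>0 < K\<close> by (intro mult_left_mono) auto
  moreover have "K * ((25 * s - 3) / 33) = 1" using \<open>3 / 25 < s\<close> by (simp add: K_def s_eq)
  ultimately show "1 + K * (1 / 200) \<le> K * (22 / 25 * s1 * (1 - 1 / 200) / (s2 + 3 / 25 * s1))"
    by (simp only: distrib_left)
qed

text \<open>Pure arithmetic in real variables: \<open>\<nu>\<close> stands for
  \<open>norm S\<close>, \<open>P\<close> for \<open>p powr (3/2)\<close>, and \<open>g1\<close>,
  \<open>g2\<close>, \<open>g3\<close> for the \<open>gamma\<close> factors of sketch, Householder
  factorization and triangular solve. The scale \<open>h\<close> satisfies
  \<open>u * \<sigma>1 = h * T\<close>, which turns the hypothesis on \<delta> into
  \<open>A + C \<le> 1 / 383\<close> and measures all errors in units of \<open>T\<close>.\<close>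

lemma roundoff_bounds:
  fixes n p m u \<epsilon> \<sigma>1 \<sigma>m \<nu> P g1 g2 g3 :: real
  assumes "2 \<le> m" "m \<le> p" "p \<le> n" "0 < u" "0 \<le> \<epsilon>" "\<epsilon> < 1" "0 < \<sigma>m" "\<sigma>m \<le> \<sigma>1" "0 \<le> \<nu>" "0 \<le> P"
  defines "s1 \<equiv> sqrt (1 - \<epsilon>)" and "s2 \<equiv> sqrt (1 + \<epsilon>)"
  assumes \<delta>: "383 * (p * (m * sqrt m) + sqrt m * (P * s2 + n * \<nu>)) / s1 * u * (\<sigma>1 / \<sigma>m) \<le> 1"
  shows "29 * p * m * u \<le> 1 / 12"
    and "\<lbrakk>0 \<le> g1; g1 \<le> n * u / (1 - 1 / 24); 0 \<le> g2; g2 \<le> 29 * p * m * u / (1 - 1 / 12)\<rbrakk> \<Longrightarrow>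
      g1 * (\<nu> * (sqrt m * \<sigma>1)) + g2 * (s2 * (sqrt m * \<sigma>1) + g1 * (\<nu> * (sqrt m * \<sigma>1)))
        \<le> 3 / 25 * s1 * \<sigma>m"
    and "\<lbrakk>0 \<le> g3; g3 \<le> m * u / (1 - 1 / 24)\<rbrakk> \<Longrightarrow>
      g3 * ((s2 + 3 / 25 * s1) * (sqrt m * \<sigma>1)) * sqrt m \<le> 1 / 200 * (22 / 25 * s1 * \<sigma>m)"
proof -
  define h where "h = u * (\<sigma>1 / \<sigma>m) / s1"
  define A where "A = p * m * sqrt m * h"
  define C where "C = sqrt m * n * \<nu> * h"
  define T where "T = s1 * \<sigma>m"
  have s: "0 < s1" "s1 \<le> 1" "0 \<le> s2" using assms(5,6) by (simp_all add: s1_def s2_def)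
  have "s2 \<le> sqrt 2" using assms(5,6) by (simp add: s2_def)
  also have "sqrt 2 \<le> 71 / 50" by (rule real_le_lsqrt) (simp_all add: power2_eq_square)
  finally have s2: "s2 \<le> 71 / 50" .
  have u\<sigma>: "u * \<sigma>1 = h * T" using s assms(7) by (simp add: h_def T_def)
  \<comment> \<open>Both \<open>\<sigma>1 / \<sigma>m\<close> and \<open>1 / s1\<close> are at least
    1, so bounds on \<open>h\<close> are bounds on \<open>u\<close>.\<close>
  have "u * 1 \<le> u * (\<sigma>1 / \<sigma>m / s1)"
    using s assms(4,7,8) by (intro mult_left_mono) (simp_all add: field_simps, smt (verit) mult_left_le)
  then have hu: "u \<le> h" by (simp add: h_def)
  then have h: "0 < h" using assms(4) by simp
  have "0 < T" using s assms(7) by (simp add: T_def)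
  have rm: "1 \<le> sqrt m" using assms(1) by simp
  have pos: "0 \<le> A" "0 \<le> C" using assms h rm by (simp_all add: A_def C_def)
  have "383 * (A + C + sqrt m * P * s2 * h) \<le> 1"
    using \<delta> by (simp add: A_def C_def h_def algebra_simps add_divide_distrib)
  moreover have "0 \<le> sqrt m * P * s2 * h" using assms(10) s h rm by simp
  ultimately have AC: "A + C \<le> 1 / 383" by simp
  have pmh: "p * m * h \<le> A"
    using mult_left_mono[OF rm, of "p * m * h"] assms(1,2) h by (simp add: A_def mult_ac)
  moreover have "p * m * u \<le> p * m * h" using hu assms(1,2) by (simp add: mult_left_mono)
  ultimately have pmu: "p * m * u \<le> 1 / 383" using AC pos by linarith
  \<comment> \<open>Here \<open>29 * 12 = 348\<close> is below 383.\<close>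
  then show "29 * p * m * u \<le> 1 / 12" by simp
  show "g1 * (\<nu> * (sqrt m * \<sigma>1)) + g2 * (s2 * (sqrt m * \<sigma>1) + g1 * (\<nu> * (sqrt m * \<sigma>1)))
        \<le> 3 / 25 * s1 * \<sigma>m"
    if g: "0 \<le> g1" "g1 \<le> n * u / (1 - 1 / 24)" "0 \<le> g2" "g2 \<le> 29 * p * m * u / (1 - 1 / 12)"
  proof -
    define e1 where "e1 = g1 * (\<nu> * (sqrt m * \<sigma>1))"
    have "e1 \<le> n * u / (1 - 1 / 24) * (\<nu> * (sqrt m * \<sigma>1))"
      unfolding e1_def using g assms(7-9) rm by (intro mult_right_mono) auto
    also have "\<dots> = 24 / 23 * (sqrt m * n * \<nu> * (u * \<sigma>1))" by simp
    also have "\<dots> = 24 / 23 * C * T" by (simp only: u\<sigma>) (simp add: C_def)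
    finally have e1: "e1 \<le> 24 / 23 * C * T" .
    have "0 \<le> e1" using g assms(7-9) rm by (simp add: e1_def)
    have "g2 * (sqrt m * \<sigma>1) \<le> 29 * p * m * u / (1 - 1 / 12) * (sqrt m * \<sigma>1)"
      using g assms(7-9) rm by (intro mult_right_mono) auto
    also have "\<dots> = 348 / 11 * (p * m * sqrt m * (u * \<sigma>1))" by simp
    also have "\<dots> = 348 / 11 * A * T" by (simp only: u\<sigma>) (simp add: A_def)
    finally have "g2 * (sqrt m * \<sigma>1) \<le> 348 / 11 * A * T" .
    with s2 have "s2 * (g2 * (sqrt m * \<sigma>1)) \<le> 71 / 50 * (348 / 11 * A * T)"
      by (rule mult_mono) (use g assms(7,8) rm in auto)
    \<comment> \<open>The bound \<open>1 / 383\<close> on \<open>p * m * u\<close> gives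
      \<open>g2 \<le> 348 / (11 * 383)\<close>, just below \<open>1 / 12\<close>.\<close>
    moreover have "g2 * e1 \<le> 1 / 12 * e1"
      using g pmu \<open>0 \<le> e1\<close> by (intro mult_right_mono) auto
    ultimately have "e1 + g2 * (s2 * (sqrt m * \<sigma>1) + e1)
        \<le> 13 / 12 * (24 / 23 * C * T) + 71 / 50 * (348 / 11 * A * T)"
      using e1 by (simp add: algebra_simps)
    also have "\<dots> = (26 / 23 * C + 12354 / 275 * A) * T" by (simp add: algebra_simps)
    \<comment> \<open>Both coefficients are below 45, and
      \<open>45 / 383 < 45 / 375 = 3 / 25\<close>.\<close>
    also have "\<dots> \<le> 3 / 25 * T"
      using AC pos \<open>0 < T\<close> by (intro mult_right_mono) auto
    finally show ?thesis by (simp add: e1_def T_def)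
  qed
  show "g3 * ((s2 + 3 / 25 * s1) * (sqrt m * \<sigma>1)) * sqrt m \<le> 1 / 200 * (22 / 25 * s1 * \<sigma>m)"
    if g: "0 \<le> g3" "g3 \<le> m * u / (1 - 1 / 24)"
  proof -
    have "g3 * ((s2 + 3 / 25 * s1) * (sqrt m * \<sigma>1)) * sqrt m = g3 * (s2 + 3 / 25 * s1) * (m * \<sigma>1)"
      using assms(1) by simp
    \<comment> \<open>The constant is \<open>71 / 50 + 3 / 25\<close>, from the bounds on
      \<open>s2\<close> and \<open>s1\<close>.\<close>
    also have "\<dots> \<le> m * u / (1 - 1 / 24) * (77 / 50) * (m * \<sigma>1)"
      using g s s2 assms(1,4,7,8) by (intro mult_right_mono mult_mono) auto
    also have "\<dots> = 924 / 575 * (m * m * (u * \<sigma>1))" by simp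
    also have "\<dots> = 924 / 575 * (m * m * h) * T" by (simp only: u\<sigma> mult.assoc)
    also have "\<dots> \<le> 924 / 575 * (1 / 383) * T"
    proof -
      have "m * m * h \<le> p * m * h" using assms(1,2) h by (intro mult_right_mono) auto
      with pmh AC pos show ?thesis using \<open>0 < T\<close> by (intro mult_right_mono mult_left_mono) auto
    qed
    also have "\<dots> \<le> 1 / 200 * (22 / 25 * T)" using \<open>0 < T\<close> by simp
    finally show ?thesis by (simp add: T_def)
  qed
qed

text \<open>The deterministic core, for one fixed embedding \<open>S\<close>. Up to an isometry
  \<open>R\<close> is \<open>S ** V + E1 + E2\<close>, with \<open>E1\<close> the error of the
  sketch and \<open>E2\<close> that of the factorization.\<close>

lemma fl_randQR_cond_number_le:
  fixes S :: "real^'n^'p" and V :: "real^'m::{finite,wellorder}^'n"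
  assumes "0 \<le> \<epsilon>" and "\<epsilon> < 616 / 634"
    and emb: "subspace_embedding \<epsilon> (range ((*v) V)) S"
    and "rank V = CARD('m)"
    and "1 < CARD('m)" and "CARD('m) \<le> CARD('p)" and "CARD('p) \<le> CARD('n)"
    and "0 < u" and nmu: "real CARD('n) * real CARD('m) * u \<le> 1 / 12"
    and \<delta>: "randQR_delta u \<epsilon> S V \<le> 1" and fl: "fl_randQR u S V Q R"
  shows "rank Q = CARD('m) \<and> cond_number Q \<le> 33 / (25 * sqrt ((1 - \<epsilon>) / (1 + \<epsilon>)) - 3)"
proof -
  let ?n = "real CARD('n)" and ?p = "real CARD('p)" and ?m = "real CARD('m)"
  let ?s1 = "sqrt (1 - \<epsilon>)" and ?s2 = "sqrt (1 + \<epsilon>)"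
  let ?\<sigma>1 = "sigma_max V" and ?\<sigma>m = "sigma_min V"
  let ?g1 = "gamma CARD('n) u" and ?g2 = "gamma (29 * CARD('p) * CARD('m)) u" and ?g3 = "gamma CARD('m) u"
  let ?a = "22 / 25 * ?s1" and ?b = "?s2 + 3 / 25 * ?s1"
  have dims: "2 \<le> ?m" "?m \<le> ?p" "?p \<le> ?n" using assms(5-7) by simp_all
  have \<epsilon>: "\<epsilon> < 1" using assms(2) by simp
  have \<sigma>: "0 < ?\<sigma>m" "?\<sigma>m \<le> ?\<sigma>1"
    using sigma_min_pos[OF assms(4)] sigma_min_le_sigma_max by auto
  have "?m powr (3 / 2) = ?m powr 1 * ?m powr (1 / 2)" unfolding powr_add[symmetric] by simp
  then have "?m powr (3 / 2) = ?m * sqrt ?m" by (simp add: powr_half_sqrt)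
  with \<delta> have \<delta>': "383 * (?p * (?m * sqrt ?m) + sqrt ?m * (?p powr (3/2) * ?s2 + ?n * norm S))
      / ?s1 * u * (?\<sigma>1 / ?\<sigma>m) \<le> 1"
    by (simp add: randQR_delta_def cond_number_def)
  note roundoff = roundoff_bounds[OF dims \<open>0 < u\<close> \<open>0 \<le> \<epsilon>\<close> \<epsilon> \<sigma> norm_ge_zero powr_ge_zero \<delta>']
  \<comment> \<open>At least two columns: this halves the bound \<open>1 / 12\<close> to
    \<open>1 / 24\<close>.\<close>
  have "?n * 2 * u \<le> ?n * ?m * u" using dims \<open>0 < u\<close> by (intro mult_right_mono mult_left_mono) auto
  also note nmu
  finally have nu: "?n * u \<le> 1 / 24" by simp
  moreover have "?m * u \<le> ?n * u" using dims \<open>0 < u\<close> by (intro mult_right_mono) auto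
  ultimately have mu: "?m * u \<le> 1 / 24" by simp
  note g1 = gamma_bounds[OF less_imp_le[OF \<open>0 < u\<close>] nu]
  note g3 = gamma_bounds[OF less_imp_le[OF \<open>0 < u\<close>] mu]
  have pmu: "real (29 * CARD('p) * CARD('m)) * u \<le> 1 / 12" using roundoff(1) by simp
  note g2 = gamma_bounds[OF less_imp_le[OF \<open>0 < u\<close>] pmu]

  from fl obtain W where W: "fl_matrix_product u S V W" and WR: "fl_householder_qr u W R"
      and RQ: "fl_triangular_row_solve u R V Q"
    by (auto simp: fl_randQR_def)
  have SV: "?s1 * norm (V *v y) \<le> norm (S *v (V *v y))" "norm (S *v (V *v y)) \<le> ?s2 * norm (V *v y)" for y
    using embedding_norm_bounds[OF emb, of "V *v y"] \<open>0 \<le> \<epsilon>\<close> \<epsilon> by auto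
  have normV: "norm V \<le> sqrt ?m * ?\<sigma>1"
    using \<sigma> norm_mult_le_sigma_max by (intro norm_matrix_le_sqrt_columns) auto
  \<comment> \<open>The columns of \<open>V\<close> lie in the embedded subspace, so the factor is
    \<open>?s2\<close> and not \<open>norm S\<close>.\<close>
  have "norm (S ** V) \<le> ?s2 * norm V"
  proof (rule norm_matrix_le_columns)
    show "norm (column j (S ** V)) \<le> ?s2 * norm (column j V)" for j
      using SV(2)[of "axis j 1"] by (simp add: column_matrix_mult matrix_vector_mult_basis)
  qed (use \<open>0 \<le> \<epsilon>\<close> in simp)
  also have "\<dots> \<le> ?s2 * (sqrt ?m * ?\<sigma>1)" using normV \<open>0 \<le> \<epsilon>\<close> by (intro mult_left_mono) auto
  finally have normSV: "norm (S ** V) \<le> ?s2 * (sqrt ?m * ?\<sigma>1)" .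
  define E1 where "E1 = W - S ** V"
  have "norm E1 \<le> ?g1 * (norm S * norm V)"
    unfolding E1_def using W g1(1) by (intro fl_matrix_product_error) auto
  also have "\<dots> \<le> ?g1 * (norm S * (sqrt ?m * ?\<sigma>1))"
    using normV g1(1) by (intro mult_left_mono) auto
  finally have E1: "norm E1 \<le> ?g1 * (norm S * (sqrt ?m * ?\<sigma>1))" .
  obtain E2 where E2: "norm E2 \<le> ?g2 * norm W" and R: "\<And>y. norm (R *v y) = norm ((W + E2) *v y)"
    using fl_householder_qr_error[OF WR] g2(1) by auto
  have "norm W \<le> norm (S ** V) + norm E1"
    using norm_triangle_ineq[of "S ** V" E1] by (simp add: E1_def)
  with normSV E1 have "?g2 * norm W \<le> ?g2 * (?s2 * (sqrt ?m * ?\<sigma>1) + ?g1 * (norm S * (sqrt ?m * ?\<sigma>1)))"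
    using g2(1) by (intro mult_left_mono) auto
  with E1 E2 have "norm E1 + norm E2 \<le> ?g1 * (norm S * (sqrt ?m * ?\<sigma>1))
      + ?g2 * (?s2 * (sqrt ?m * ?\<sigma>1) + ?g1 * (norm S * (sqrt ?m * ?\<sigma>1)))"
    by linarith
  also have "\<dots> \<le> 3 / 25 * ?s1 * ?\<sigma>m"
    using g1 g2 by (intro roundoff(2)) simp_all
  finally have E12: "norm (E1 + E2) \<le> 3 / 25 * ?s1 * ?\<sigma>m"
    using norm_triangle_ineq[of E1 E2] by linarith
  \<comment> \<open>The factor \<open>?\<sigma>m\<close> turns the absolute error into one relative
    to \<open>norm (V *v y)\<close>.\<close>
  have E: "norm ((E1 + E2) *v y) \<le> 3 / 25 * ?s1 * norm (V *v y)" for y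
  proof -
    have "norm ((E1 + E2) *v y) \<le> norm (E1 + E2) * norm y" by (rule norm_matrix_vector_mult_le)
    also have "\<dots> \<le> 3 / 25 * ?s1 * ?\<sigma>m * norm y"
      using E12 by (rule mult_right_mono) simp
    also have "\<dots> = 3 / 25 * ?s1 * (?\<sigma>m * norm y)" by simp
    also have "\<dots> \<le> 3 / 25 * ?s1 * norm (V *v y)"
      using \<epsilon> by (intro mult_left_mono sigma_min_le_norm_mult) auto
    finally show ?thesis .
  qed
  have Ry: "norm (R *v y) = norm (S *v (V *v y) + (E1 + E2) *v y)" for y
    unfolding R by (simp add: E1_def matrix_vector_mul_assoc flip: matrix_vector_mult_add_rdistrib)
  have R_lower: "?a * norm (V *v y) \<le> norm (R *v y)" for y
    using SV(1)[of y] E[of y] norm_diff_ineq[of "S *v (V *v y)" "(E1 + E2) *v y"] by (simp add: Ry)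
  have R_upper: "norm (R *v y) \<le> ?b * norm (V *v y)" for y
    using SV(2)[of y] E[of y] norm_triangle_ineq[of "S *v (V *v y)" "(E1 + E2) *v y"]
    by (simp add: Ry distrib_right)
  have "0 < ?s1" "0 < ?s2" using \<open>0 \<le> \<epsilon>\<close> \<epsilon> by simp_all
  then have "0 < ?b" by linarith
  have "norm R \<le> ?b * norm V"
  proof (rule norm_matrix_le_columns)
    show "norm (column j R) \<le> ?b * norm (column j V)" for j
      using R_upper[of "axis j 1"] by (simp add: matrix_vector_mult_basis)
  qed (use \<open>0 < ?b\<close> in simp)
  also have "\<dots> \<le> ?b * (sqrt ?m * ?\<sigma>1)" using normV \<open>0 < ?b\<close> by (intro mult_left_mono) auto
  finally have normR: "norm R \<le> ?b * (sqrt ?m * ?\<sigma>1)" .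
  have N: "0 \<le> sigma_max Q"
    using sigma_max_attained[of Q] by (metis norm_ge_zero)
  \<comment> \<open>The residual bound involves the unknown \<open>Q\<close> itself; in terms of
    \<open>sigma_max Q\<close> it has the form that \<open>cond_number_perturbed_quotient\<close>
    absorbs.\<close>
  have normQ: "norm Q \<le> sqrt ?m * sigma_max Q"
    using N norm_mult_le_sigma_max by (intro norm_matrix_le_sqrt_columns) auto
  have residual: "norm (Q *v (R *v y) - V *v y) \<le> 1 / 200 * sigma_max Q * norm (R *v y)" for y
  proof -
    have "norm (Q *v (R *v y) - V *v y) \<le> ?g3 * norm R * norm y * norm Q"
      using RQ g3(1) by (intro fl_triangular_row_solve_error) auto
    also have "\<dots> \<le> ?g3 * (?b * (sqrt ?m * ?\<sigma>1)) * norm y * (sqrt ?m * sigma_max Q)"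
      using normR normQ g3(1) \<open>0 < ?b\<close> \<sigma> by (intro mult_mono mult_nonneg_nonneg) auto
    also have "\<dots> = ?g3 * (?b * (sqrt ?m * ?\<sigma>1)) * sqrt ?m * (norm y * sigma_max Q)" by (simp only: mult_ac)
    also have "\<dots> \<le> 1 / 200 * (?a * ?\<sigma>m) * (norm y * sigma_max Q)"
      using roundoff(3)[of ?g3] g3 N by (intro mult_right_mono) auto
    also have "\<dots> = 1 / 200 * sigma_max Q * (?a * (?\<sigma>m * norm y))" by (simp only: mult_ac)
    also have "\<dots> \<le> 1 / 200 * sigma_max Q * (?a * norm (V *v y))"
      using \<open>0 < ?s1\<close> N by (intro mult_left_mono sigma_min_le_norm_mult) auto
    also have "\<dots> \<le> 1 / 200 * sigma_max Q * norm (R *v y)"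
      using R_lower N by (intro mult_left_mono) auto
    finally show ?thesis .
  qed
  show ?thesis
    using cond_bound_constants[OF assms(1,2)] \<open>0 < ?s1\<close> \<open>0 < ?b\<close>
    by (intro cond_number_perturbed_quotient[OF assms(4) _ _ _ _ _ R_lower R_upper residual]) auto
qed

subsection \<open>The embedding event\<close>

text \<open>For each pair of vectors the condition is a non-strict inequality between continuous
  functions of \<open>S\<close>. Closedness makes the embedding event measurable.\<close>

lemma closed_subspace_embedding: "closed {S :: real^'n^'p. subspace_embedding \<epsilon> U S}"
proof -
  have cont: "continuous_on UNIV (\<lambda>S :: real^'n^'p. S *v x)" for x
    by (intro linear_continuous_on, simp add: linear_conv_bounded_linear[symmetric], rule linearI)
      (simp_all add: matrix_vector_mult_add_rdistrib scaleR_matrix_vector_assoc)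
  show ?thesis
    unfolding subspace_embedding_def Collect_ball_eq
    by (intro closed_INT ballI closed_Collect_le continuous_intros cont)
qed

lemma with_probability_at_least_mono:
  assumes "with_probability_at_least M q P" and "\<And>\<omega>. P \<omega> \<Longrightarrow> P' \<omega>"
  shows "with_probability_at_least M q P'"
  using assms unfolding with_probability_at_least_def by blast

lemma oblivious_subspace_embedding_event:
  fixes S :: "'a \<Rightarrow> real^'n^'p"
  assumes "oblivious_subspace_embedding M S \<epsilon> d k" and "subspace U" and "dim U = k"
  shows "with_probability_at_least M (1 - d) (\<lambda>\<omega>. subspace_embedding \<epsilon> U (S \<omega>))"
proof -
  have S: "S \<in> borel_measurable M"
    and prob: "1 - d \<le> measure M {\<omega> \<in> space M. subspace_embedding \<epsilon> U (S \<omega>)}"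
    using assms by (auto simp: oblivious_subspace_embedding_def)
  have "S -` {T. subspace_embedding \<epsilon> U T} \<inter> space M \<in> sets M"
    by (rule measurable_sets[OF S borel_closed[OF closed_subspace_embedding]])
  also have "S -` {T. subspace_embedding \<epsilon> U T} \<inter> space M = {\<omega> \<in> space M. subspace_embedding \<epsilon> U (S \<omega>)}"
    by auto
  finally show ?thesis using prob unfolding with_probability_at_least_def by blast
qed

theorem corollary5p2:
  fixes M :: "'a measure"
    and S :: "'a \<Rightarrow> real^'n^'p"
    and V :: "real^'m::{finite,wellorder}^'n"
    and \<epsilon> d u :: real
  assumes "0 \<le> \<epsilon>" and "\<epsilon> < 616 / 634"
    and "oblivious_subspace_embedding M S \<epsilon> d CARD('m)"
    and "rank V = CARD('m)"
    and "1 < CARD('m)" and "CARD('m) \<le> CARD('p)" and "CARD('p) \<le> CARD('n)"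
    and "0 < u"
    and "real CARD('n) * real CARD('m) * u \<le> 1 / 12"
    and "real CARD('p) powr (3/2) * u \<le> 1 / 12"
  shows "with_probability_at_least M (1 - d)
           (\<lambda>\<omega>. randQR_delta u \<epsilon> (S \<omega>) V \<le> 1 \<longrightarrow>
              (\<forall>Q R. fl_randQR u (S \<omega>) V Q R \<longrightarrow>
                 rank Q = CARD('m) \<and>
                 cond_number Q \<le> 33 / (25 * sqrt ((1 - \<epsilon>) / (1 + \<epsilon>)) - 3)))
       \<and> (\<epsilon> \<le> 0.9 \<longrightarrow>
           with_probability_at_least M (1 - d)
             (\<lambda>\<omega>. randQR_delta u \<epsilon> (S \<omega>) V \<le> 1 \<longrightarrow>
                (\<forall>Q R. fl_randQR u (S \<omega>) V Q R \<longrightarrow>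
                   rank Q = CARD('m) \<and> cond_number Q \<le> 12.07)))"
proof (intro conjI impI)
  have "subspace (range ((*v) V))" by (simp add: subspace_UNIV linear_subspace_image)
  moreover have "dim (range ((*v) V)) = CARD('m)" using assms(4) by (simp add: rank_dim_range)
  ultimately have "with_probability_at_least M (1 - d) (\<lambda>\<omega>. subspace_embedding \<epsilon> (range ((*v) V)) (S \<omega>))"
    by (rule oblivious_subspace_embedding_event[OF assms(3)])
  then show general: "with_probability_at_least M (1 - d)
           (\<lambda>\<omega>. randQR_delta u \<epsilon> (S \<omega>) V \<le> 1 \<longrightarrow>
              (\<forall>Q R. fl_randQR u (S \<omega>) V Q R \<longrightarrow>
                 rank Q = CARD('m) \<and>
                 cond_number Q \<le> 33 / (25 * sqrt ((1 - \<epsilon>) / (1 + \<epsilon>)) - 3)))"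
    by (rule with_probability_at_least_mono)
      (use fl_randQR_cond_number_le[OF assms(1,2) _ assms(4-9)] in blast)
  assume "\<epsilon> \<le> 0.9"
  \<comment> \<open>At \<open>\<epsilon> = 0.9\<close> the radicand is \<open>1 / 19\<close>, whose
    root is rounded down to \<open>0.2294\<close>; then
    \<open>33 / (25 * 0.2294 - 3) = 33 / 2.735 < 12.07\<close>.\<close>
  have "2294 / 10000 \<le> sqrt ((1 - \<epsilon>) / (1 + \<epsilon>))"
    using \<open>\<epsilon> \<le> 0.9\<close> assms(1) by (intro real_le_rsqrt) (simp add: power2_eq_square field_simps)
  then have "33 / (25 * sqrt ((1 - \<epsilon>) / (1 + \<epsilon>)) - 3) \<le> 12.07" by (simp add: divide_le_eq)
  then show "with_probability_at_least M (1 - d)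
             (\<lambda>\<omega>. randQR_delta u \<epsilon> (S \<omega>) V \<le> 1 \<longrightarrow>
                (\<forall>Q R. fl_randQR u (S \<omega>) V Q R \<longrightarrow>
                   rank Q = CARD('m) \<and> cond_number Q \<le> 12.07))"
    by (intro with_probability_at_least_mono[OF general]) (meson order_trans)
qed

end
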